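(* Let $G$ be a finitely generated group and let $d$ be a proper left-invariant metric on $G$ taking integer values. Then the annihilator $N=N_{\partial(G,d)}$ is a locally finite group; i.e., any finitely generated subgroup of $N$ is finite.
   Context: A metric $d$ on $G$ is left-invariant if $d(zx,zy)=d(x,y)$ for all $x,y,z\in G$. It is proper if every ball $\{y\in G : d(x,y)\le r\}$ ($x\in G$, $r\ge 0$) is compact, i.e. finite, as $G$ is a countable discrete space. Metric-functional boundary: for $x\in G$ let $b_x\colon G\to\mathbb{R}$, $b_x(y)=d(x,y)-d(x,1)$. Let $\overline{(G,d)}$ be the closure of $\{b_x : x\in G\}$ in the space of functions $G\to\mathbb{R}$ with the topology of pointwise convergence. Then $\partial(G,d)=\overline{(G,d)}\setminus\{b_x : x\in G\}$. Annihilator: for $L\subseteq\partial(G,d)$, $N_L=\{x\in G : h(x)=0\text{ for all }h\in L\}$. The annihilator $N_{\partial(G,d)}$ is a subgroup of $G$. *)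

theory Defs
  imports "HOL-Analysis.Analysis" "HOL-Algebra.Generated_Groups"
begin

definition finitely_generated_group :: "('a, 'b) monoid_scheme \<Rightarrow> bool" where
  "finitely_generated_group G \<longleftrightarrow>
     group G \<and> (\<exists>S. finite S \<and> S \<subseteq> carrier G \<and> generate G S = carrier G)"

definition locally_finite_group :: "('a, 'b) monoid_scheme \<Rightarrow> bool" where
  "locally_finite_group G \<longleftrightarrow>
     group G \<and>
     (\<forall>H. subgroup H G \<and> finitely_generated_group (G\<lparr>carrier := H\<rparr>) \<longrightarrow> finite H)"

definition left_invariant_metric ::
    "('a, 'b) monoid_scheme \<Rightarrow> ('a \<Rightarrow> 'a \<Rightarrow> real) \<Rightarrow> bool" where
  "left_invariant_metric G d \<longleftrightarrow>
     (\<forall>x\<in>carrier G. \<forall>y\<in>carrier G. \<forall>z\<in>carrier G.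
        d (z \<otimes>\<^bsub>G\<^esub> x) (z \<otimes>\<^bsub>G\<^esub> y) = d x y)"

(* Compactness refers to the discrete topology that the group carries, not to the
   topology induced by d, so a compact ball is the same thing as a finite ball. *)
definition proper_metric ::
    "('a, 'b) monoid_scheme \<Rightarrow> ('a \<Rightarrow> 'a \<Rightarrow> real) \<Rightarrow> bool" where
  "proper_metric G d \<longleftrightarrow>
     (\<forall>x\<in>carrier G. \<forall>r\<ge>0.
        compactin (discrete_topology (carrier G)) (Metric_space.mcball (carrier G) d x r))"

lemma proper_metric_iff_finite:
  assumes "Metric_space (carrier G) d"
  shows "proper_metric G d \<longleftrightarrow>
           (\<forall>x\<in>carrier G. \<forall>r\<ge>0. finite {y \<in> carrier G. d x y \<le> r})"
proof -
  have "Metric_space.mcball (carrier G) d x r = {y \<in> carrier G. d x y \<le> r}"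
    if "x \<in> carrier G" for x r
    using that by (auto simp: Metric_space.mcball_def[OF assms])
  then show ?thesis
    unfolding proper_metric_def by (simp add: compactin_discrete_topology)
qed

(* Functions on the group are represented by the extensional functions on its carrier,
   which are the points of the product topology below. *)
definition metric_functional ::
    "('a, 'b) monoid_scheme \<Rightarrow> ('a \<Rightarrow> 'a \<Rightarrow> real) \<Rightarrow> 'a \<Rightarrow> 'a \<Rightarrow> real" where
  "metric_functional G d x = (\<lambda>y\<in>carrier G. d x y - d x \<one>\<^bsub>G\<^esub>)"

definition metric_compactification ::
    "('a, 'b) monoid_scheme \<Rightarrow> ('a \<Rightarrow> 'a \<Rightarrow> real) \<Rightarrow> ('a \<Rightarrow> real) set" where
  "metric_compactification G d =
     product_topology (\<lambda>_. euclideanreal) (carrier G)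
       closure_of (metric_functional G d ` carrier G)"

definition metric_boundary ::
    "('a, 'b) monoid_scheme \<Rightarrow> ('a \<Rightarrow> 'a \<Rightarrow> real) \<Rightarrow> ('a \<Rightarrow> real) set" where
  "metric_boundary G d = metric_compactification G d - metric_functional G d ` carrier G"

definition annihilator :: "('a, 'b) monoid_scheme \<Rightarrow> ('a \<Rightarrow> real) set \<Rightarrow> 'a set" where
  "annihilator G L = {x \<in> carrier G. \<forall>h\<in>L. h x = 0}"

end

theory Submission imports Defs begin

text \<open>
  Write \<open>\<bar>u\<bar> = d 1 u\<close>. If \<open>t\<close> lies in the annihilator, then the set of all
  functionals \<open>f\<close> of the compactification with \<open>f t \<noteq> 0\<close> is compact (integrality makes
  this condition closed) and consists of interior points \<open>b\<^sub>z\<close>. Covering it by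
  neighbourhoods of these points yields finitely many \<open>z\<close> such that, whenever
  \<open>\<bar>u t\<bar> \<noteq> \<bar>u\<bar>\<close>, some \<open>c = u z\<close> satisfies \<open>\<bar>c y\<bar> = \<bar>c\<bar> + \<bar>y\<bar>\<close> for all \<open>\<bar>y\<bar> \<le> R z\<close>, where
  the radius \<open>R z\<close> can be prescribed. Take finitely many such \<open>t\<close>, of length at most \<open>D\<close>, and
  \<open>R z = \<bar>z\<bar> + 2 D\<close>. A path in the subgroup they generate that starts at \<open>1\<close> can exceed a
  large level \<open>M\<close> for the first time only right after a point \<open>u\<close> of the ball about such a
  \<open>c\<close>; but the point at which the path entered this ball has length greater than
  \<open>\<bar>c\<bar> + R z - D > M\<close>. So the subgroup has bounded length and is finite by properness.
\<close>

locale proper_integral_metric_group =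
  group G + Metric_space "carrier G" d for G (structure) and d +
  assumes left_invariant: "left_invariant_metric G d"
    and proper: "proper_metric G d"
    and integral: "\<And>x y. x \<in> carrier G \<Longrightarrow> y \<in> carrier G \<Longrightarrow> d x y \<in> \<int>"
begin

section \<open>Word length attached to the metric\<close>

abbreviation functional_topology :: "('a \<Rightarrow> real) topology" where
  "functional_topology \<equiv> product_topology (\<lambda>_. euclideanreal) (carrier G)"

abbreviation len :: "'a \<Rightarrow> real" where
  "len u \<equiv> d \<one> u"

lemma dist_mult_left:
  assumes "x \<in> carrier G" "y \<in> carrier G" "z \<in> carrier G"
  shows "d (z \<otimes> x) (z \<otimes> y) = d x y"
  using left_invariant assms unfolding left_invariant_metric_def by blast

text \<open>This is why functionals are evaluated at \<open>inv u\<close> below: the one based there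
  is the increment \<open>len (u \<otimes> y) - len u\<close>.\<close>

lemma dist_inv_left:
  assumes "u \<in> carrier G" "y \<in> carrier G"
  shows "d (inv u) y = len (u \<otimes> y)"
  using dist_mult_left[of "inv u" y u] assms by simp

lemma len_mult_le:
  assumes "x \<in> carrier G" "y \<in> carrier G"
  shows "len (x \<otimes> y) \<le> len x + len y"
  using triangle[of \<one> x "x \<otimes> y"] dist_mult_left[of \<one> y x] assms by simp

lemma len_inv:
  assumes "x \<in> carrier G"
  shows "len (inv x) = len x"
  using dist_inv_left[of x \<one>] commute[of \<one> "inv x"] assms by simp

lemma finite_ball: "finite {y \<in> carrier G. len y \<le> r}"
proof (cases "r \<ge> 0")
  case True
  then show ?thesis
    using proper proper_metric_iff_finite[OF Metric_space_axioms] by auto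
next
  case False
  then have "{y \<in> carrier G. len y \<le> r} = {}"
    using nonneg order_trans by blast
  then show ?thesis by (metis finite.emptyI)
qed

section \<open>The metric compactification\<close>

lemma compactification_subset: "metric_compactification G d \<subseteq> topspace functional_topology"
  unfolding metric_compactification_def by (rule closure_of_subset_topspace)

lemma compactification_subset_closed:
  assumes "closedin functional_topology C" "metric_functional G d ` carrier G \<subseteq> C"
  shows "metric_compactification G d \<subseteq> C"
  unfolding metric_compactification_def using assms by (rule closure_of_minimal[rotated])

lemma functional_in_compactification:
  assumes "x \<in> carrier G"
  shows "metric_functional G d x \<in> metric_compactification G d"
proof -
  have "metric_functional G d ` carrier G \<subseteq> topspace functional_topology"
    by (auto simp: metric_functional_def)
  from closure_of_subset[OF this] show ?thesis
    using assms unfolding metric_compactification_def by blast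
qed

text \<open>The triangle inequality bounds each functional at \<open>y\<close> by
  \<open>len y\<close> in absolute value, so the closure sits inside a product of compact intervals
  and Tychonoff applies.\<close>

lemma compactin_compactification:
  "compactin functional_topology (metric_compactification G d)"
proof (rule closed_compactin)
  let ?box = "PiE (carrier G) (\<lambda>y. {- len y..len y})"
  show "compactin functional_topology ?box"
    by (simp add: compactin_PiE)
  have "\<bar>d x y - d x \<one>\<bar> \<le> len y" if "x \<in> carrier G" "y \<in> carrier G" for x y
    using triangle[of x \<one> y] triangle[of x y \<one>] commute[of y \<one>] that by auto
  then have "metric_functional G d ` carrier G \<subseteq> ?box"
    by (force simp: metric_functional_def abs_le_iff)
  moreover have "closedin functional_topology ?box"
    by (simp add: closedin_product_topology)
  ultimately show "metric_compactification G d \<subseteq> ?box"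
    by (rule compactification_subset_closed[rotated])
  show "closedin functional_topology (metric_compactification G d)"
    unfolding metric_compactification_def by simp
qed

lemma compactification_one:
  assumes "f \<in> metric_compactification G d"
  shows "f \<one> = 0"
proof -
  have "closedin functional_topology {f \<in> topspace functional_topology. f \<one> \<in> {0}}"
    by (rule closedin_continuous_map_preimage[OF continuous_map_product_projection]) auto
  moreover have "metric_functional G d ` carrier G
      \<subseteq> {f \<in> topspace functional_topology. f \<one> \<in> {0}}"
    by (auto simp: metric_functional_def)
  ultimately show ?thesis
    using compactification_subset_closed assms by blast
qed

section \<open>Translation action and the annihilator as a subgroup\<close>

text \<open>Subtracting \<open>f g\<close> restores the normalisation at \<open>\<one>\<close>; on
  interior points this is left multiplication of the base point by \<open>inv g\<close>.\<close>

definition translate :: "'a \<Rightarrow> ('a \<Rightarrow> real) \<Rightarrow> 'a \<Rightarrow> real" where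
  "translate g f = (\<lambda>y\<in>carrier G. f (g \<otimes> y) - f g)"

lemma translate_functional:
  assumes "g \<in> carrier G" "x \<in> carrier G"
  shows "translate g (metric_functional G d x) = metric_functional G d (inv g \<otimes> x)"
proof -
  have "d (inv g \<otimes> x) y = d x (g \<otimes> y)" if "y \<in> carrier G" for y
    using dist_mult_left[of "inv g \<otimes> x" y g] assms that by (simp add: m_assoc[symmetric])
  then show ?thesis
    using assms by (auto simp: translate_def metric_functional_def)
qed

text \<open>The terms \<open>f g\<close> cancel and only \<open>f \<one> = 0\<close> remains.
  Consequently a boundary point cannot be translated to an interior one.\<close>

lemma translate_inv_translate:
  assumes "g \<in> carrier G" "f \<in> metric_compactification G d"
  shows "translate (inv g) (translate g f) = f"
proof
  fix y
  have "f \<in> extensional (carrier G)"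
    using assms(2) compactification_subset by (auto simp: PiE_def)
  then show "translate (inv g) (translate g f) y = f y"
    using assms compactification_one[OF assms(2)]
    by (auto simp: translate_def m_assoc[symmetric] extensional_def)
qed

lemma translate_compactification:
  assumes "g \<in> carrier G" "f \<in> metric_compactification G d"
  shows "translate g f \<in> metric_compactification G d"
proof -
  have cont: "continuous_map functional_topology functional_topology (translate g)"
    unfolding continuous_map_componentwise
  proof (intro conjI ballI)
    show "translate g ` topspace functional_topology \<subseteq> extensional (carrier G)"
      by (auto simp: translate_def)
    fix y assume y: "y \<in> carrier G"
    have "continuous_map functional_topology euclideanreal (\<lambda>f. f (g \<otimes> y) - f g)"
      using assms(1) y
      by (intro continuous_map_diff continuous_map_product_projection) auto
    then show "continuous_map functional_topology euclideanreal (\<lambda>f. translate g f y)"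
      using y by (simp add: translate_def)
  qed
  have "translate g ` (metric_functional G d ` carrier G) \<subseteq> metric_functional G d ` carrier G"
    using assms(1) by (auto simp: translate_functional)
  from closure_of_mono[OF this]
  show ?thesis
    using continuous_map_image_closure_subset[OF cont] assms(2)
    unfolding metric_compactification_def by blast
qed

lemma translate_boundary:
  assumes "g \<in> carrier G" "h \<in> metric_boundary G d"
  shows "translate g h \<in> metric_boundary G d"
proof -
  have h: "h \<in> metric_compactification G d" "h \<notin> metric_functional G d ` carrier G"
    using assms(2) by (auto simp: metric_boundary_def)
  have "translate g h \<notin> metric_functional G d ` carrier G"
  proof
    assume "translate g h \<in> metric_functional G d ` carrier G"
    then obtain x where x: "x \<in> carrier G" "translate g h = metric_functional G d x"
      by blast
    have "h = translate (inv g) (metric_functional G d x)"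
      using translate_inv_translate[OF assms(1) h(1)] x(2) by simp
    then show False
      using h(2) x(1) assms(1) translate_functional[of "inv g" x] by auto
  qed
  then show ?thesis
    using translate_compactification[OF assms(1) h(1)] by (simp add: metric_boundary_def)
qed

text \<open>Closure comes from the cocycle identity
  \<open>h (x \<otimes> y) = h x + translate x h y\<close>, because the translate is again a
  boundary point.\<close>

lemma subgroup_annihilator: "subgroup (annihilator G (metric_boundary G d)) G"
proof
  let ?N = "annihilator G (metric_boundary G d)"
  have zero: "h \<one> = 0" if "h \<in> metric_boundary G d" for h
    using that compactification_one by (auto simp: metric_boundary_def)
  then show "\<one> \<in> ?N"
    by (simp add: annihilator_def)
  show "?N \<subseteq> carrier G"
    by (auto simp: annihilator_def)
  fix x assume x: "x \<in> ?N"
  have "h (inv x) = 0" if h: "h \<in> metric_boundary G d" for h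
  proof -
    have "translate (inv x) h x = 0"
      using translate_boundary[OF _ h, of "inv x"] x by (simp add: annihilator_def)
    then show ?thesis
      using x zero[OF h] by (simp add: translate_def annihilator_def)
  qed
  then show "inv x \<in> ?N"
    using x by (simp add: annihilator_def)
  fix y assume y: "y \<in> ?N"
  have "h (x \<otimes> y) = 0" if h: "h \<in> metric_boundary G d" for h
  proof -
    have "translate x h y = 0"
      using translate_boundary[OF _ h, of x] x y by (simp add: annihilator_def)
    then show ?thesis
      using x y h by (simp add: translate_def annihilator_def)
  qed
  then show "x \<otimes> y \<in> ?N"
    using x y by (simp add: annihilator_def)
qed

section \<open>Local minima of the length from compactness\<close>

text \<open>Properness leaves finitely many coordinates \<open>z \<otimes> y\<close> to control, so
  controlling each to within 1 is an open condition; integrality turns it into equality.\<close>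

lemma functional_neighbourhood:
  assumes z: "z \<in> carrier G" and r: "r \<ge> 0"
  obtains U where "openin functional_topology U" "metric_functional G d z \<in> U"
    "\<And>u y. u \<in> carrier G \<Longrightarrow> metric_functional G d (inv u) \<in> U \<Longrightarrow> y \<in> carrier G \<Longrightarrow>
       len y \<le> r \<Longrightarrow> len (u \<otimes> z \<otimes> y) = len (u \<otimes> z) + len y"
proof
  let ?b = "metric_functional G d"
  let ?B = "{y \<in> carrier G. len y \<le> r}"
  let ?V = "\<lambda>y. {f \<in> topspace functional_topology. f (z \<otimes> y) \<in> ball (?b z (z \<otimes> y)) 1}"
  let ?U = "\<Inter> (insert (topspace functional_topology) (?V ` ?B))"
  have "openin functional_topology (?V y)" if "y \<in> ?B" for y
    using that z
    by (intro openin_continuous_map_preimage[OF continuous_map_product_projection]) auto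
  then show "openin functional_topology ?U"
    using finite_ball[of r]
    by (intro openin_Inter) (auto simp del: topspace_product_topology)
  show "?b z \<in> ?U"
    by (auto simp: metric_functional_def)
  fix u y
  assume u: "u \<in> carrier G" and U: "?b (inv u) \<in> ?U" and y: "y \<in> carrier G" "len y \<le> r"
  have eq: "d (inv u) (z \<otimes> v) - d (inv u) \<one> = d z (z \<otimes> v) - d z \<one>"
    if v: "v \<in> ?B" for v
  proof -
    have "?b (inv u) \<in> ?V v"
      using U v by blast
    then have "\<bar>(d z (z \<otimes> v) - d z \<one>) - (d (inv u) (z \<otimes> v) - d (inv u) \<one>)\<bar> < 1"
      using v u z by (simp add: metric_functional_def dist_real_def)
    moreover have "(d z (z \<otimes> v) - d z \<one>) - (d (inv u) (z \<otimes> v) - d (inv u) \<one>) \<in> \<int>"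
      using v u z by (intro Ints_diff integral) auto
    ultimately show ?thesis
      using Ints_nonzero_abs_less1 by force
  qed
  \<comment> \<open>Subtracting the instance at \<open>\<one>\<close>, which lies in the ball as
    \<open>r \<ge> 0\<close>, moves the base point from \<open>\<one>\<close> to
    \<open>z\<close>.\<close>
  have "d (inv u) (z \<otimes> y) - d (inv u) z = d z (z \<otimes> y)"
    using eq[of y] eq[of \<one>] y z r by simp
  moreover have "d z (z \<otimes> y) = len y"
    using dist_mult_left[of \<one> y z] y z by simp
  ultimately show "len (u \<otimes> z \<otimes> y) = len (u \<otimes> z) + len y"
    using dist_inv_left[of u] u y z by (simp add: m_assoc)
qed

lemma finite_local_minima:
  assumes t: "t \<in> annihilator G (metric_boundary G d)"
    and R: "\<And>z. z \<in> carrier G \<Longrightarrow> R z \<ge> 0"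
  obtains Z where "finite Z" "Z \<subseteq> carrier G"
    "\<And>u. u \<in> carrier G \<Longrightarrow> len (u \<otimes> t) \<noteq> len u \<Longrightarrow>
       \<exists>z\<in>Z. \<forall>y\<in>carrier G. len y \<le> R z \<longrightarrow> len (u \<otimes> z \<otimes> y) = len (u \<otimes> z) + len y"
proof -
  let ?b = "metric_functional G d"
  let ?good = "\<lambda>z U. openin functional_topology U \<and> ?b z \<in> U \<and>
    (\<forall>u\<in>carrier G. ?b (inv u) \<in> U \<longrightarrow>
      (\<forall>y\<in>carrier G. len y \<le> R z \<longrightarrow> len (u \<otimes> z \<otimes> y) = len (u \<otimes> z) + len y))"
  have "\<exists>U. ?good z U" if z: "z \<in> carrier G" for z
    by (rule functional_neighbourhood[OF z R[OF z]]) blast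
  then have "\<forall>z\<in>carrier G. \<exists>U. ?good z U"
    by (rule ballI)
  then obtain U where U: "\<forall>z\<in>carrier G. ?good z (U z)"
    by (rule bchoice[THEN exE])
  have tG: "t \<in> carrier G" and tN: "\<And>h. h \<in> metric_boundary G d \<Longrightarrow> h t = 0"
    using t by (auto simp: annihilator_def)
  \<comment> \<open>A nonzero integer has absolute value at least 1, so nonvanishing at
    \<open>t\<close> can be stated as a closed condition.\<close>
  define C where "C = metric_compactification G d \<inter>
    {f \<in> topspace functional_topology. f t \<in> - ball 0 1}"
  have "closedin functional_topology {f \<in> topspace functional_topology. f t \<in> - ball 0 1}"
    using tG by (intro closedin_continuous_map_preimage[OF continuous_map_product_projection])
      (auto simp: closed_Compl)
  then have "compactin functional_topology C"
    unfolding C_def using compactin_compactification compact_Int_closedin by blast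
  \<comment> \<open>Boundary points vanish at \<open>t\<close>, hence none lies in
    \<open>C\<close>.\<close>
  moreover have "C \<subseteq> ?b ` carrier G"
    using tN by (force simp: C_def metric_boundary_def)
  then have "C \<subseteq> \<Union> (U ` carrier G)"
    using U by blast
  moreover have "\<forall>V\<in>U ` carrier G. openin functional_topology V"
    using U by blast
  ultimately obtain F where F: "finite F" "F \<subseteq> U ` carrier G" "C \<subseteq> \<Union> F"
    by (meson compactin_def)
  then obtain Z where Z: "Z \<subseteq> carrier G" "finite Z" "F = U ` Z"
    by (meson finite_subset_image)
  show thesis
  proof (rule that[of Z])
    fix u assume u: "u \<in> carrier G" and neq: "len (u \<otimes> t) \<noteq> len u"
    have "?b (inv u) t = len (u \<otimes> t) - len u"
      using u tG by (simp add: metric_functional_def dist_inv_left)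
    moreover have "len (u \<otimes> t) - len u \<in> \<int>"
      using u tG by (intro Ints_diff integral) auto
    ultimately have "\<bar>?b (inv u) t\<bar> \<ge> 1"
      using neq Ints_nonzero_abs_ge1[of "len (u \<otimes> t) - len u"] by simp
    then have "?b (inv u) \<in> C"
      using functional_in_compactification[of "inv u"] compactification_subset u
      by (auto simp: C_def)
    then obtain z where "z \<in> Z" "?b (inv u) \<in> U z"
      using F Z by blast
    then show "\<exists>z\<in>Z. \<forall>y\<in>carrier G. len y \<le> R z \<longrightarrow>
        len (u \<otimes> z \<otimes> y) = len (u \<otimes> z) + len y"
      using U Z(1) u by blast
  qed (use Z in auto)
qed

lemma finite_local_minima_uniform:
  assumes "finite T" and T: "T \<subseteq> annihilator G (metric_boundary G d)"
    and R: "\<And>z. z \<in> carrier G \<Longrightarrow> R z \<ge> 0"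
  obtains Z where "finite Z" "Z \<subseteq> carrier G"
    "\<And>u t. u \<in> carrier G \<Longrightarrow> t \<in> T \<Longrightarrow> len (u \<otimes> t) \<noteq> len u \<Longrightarrow>
       \<exists>z\<in>Z. \<forall>y\<in>carrier G. len y \<le> R z \<longrightarrow> len (u \<otimes> z \<otimes> y) = len (u \<otimes> z) + len y"
proof -
  define P where "P u z \<longleftrightarrow>
    (\<forall>y\<in>carrier G. len y \<le> R z \<longrightarrow> len (u \<otimes> z \<otimes> y) = len (u \<otimes> z) + len y)" for u z
  let ?good = "\<lambda>t Z. finite Z \<and> Z \<subseteq> carrier G \<and>
    (\<forall>u\<in>carrier G. len (u \<otimes> t) \<noteq> len u \<longrightarrow> (\<exists>z\<in>Z. P u z))"
  have "\<exists>Z. ?good t Z" if "t \<in> T" for t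
  proof -
    from that T have "t \<in> annihilator G (metric_boundary G d)" by blast
    from finite_local_minima[of t R, OF this R]
    obtain Z where "finite Z" "Z \<subseteq> carrier G"
      "\<And>u. u \<in> carrier G \<Longrightarrow> len (u \<otimes> t) \<noteq> len u \<Longrightarrow> \<exists>z\<in>Z. P u z"
      unfolding P_def by metis
    then show ?thesis by metis
  qed
  then have "\<forall>t\<in>T. \<exists>Z. ?good t Z"
    by (rule ballI)
  then obtain Z where Z: "\<forall>t\<in>T. ?good t (Z t)"
    by (rule bchoice[THEN exE])
  show thesis
  proof (rule that[of "\<Union> (Z ` T)", folded P_def])
    show "finite (\<Union> (Z ` T))"
      using Z assms(1) by simp
    show "\<Union> (Z ` T) \<subseteq> carrier G"
      using Z by blast
    fix u t
    assume "u \<in> carrier G" "t \<in> T" "len (u \<otimes> t) \<noteq> len u"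
    then show "\<exists>z\<in>\<Union> (Z ` T). P u z"
      using Z by (meson UN_I)
  qed
qed

section \<open>Bounded length of finitely generated subgroups\<close>

lemma finite_generate_annihilator:
  assumes "finite S" and S: "S \<subseteq> annihilator G (metric_boundary G d)"
  shows "finite (generate G S)"
proof -
  interpret N: subgroup "annihilator G (metric_boundary G d)" G
    by (rule subgroup_annihilator)
  define T where "T = S \<union> m_inv G ` S"
  have T: "finite T" "T \<subseteq> annihilator G (metric_boundary G d)"
    using assms by (auto simp: T_def)
  then have TG: "T \<subseteq> carrier G"
    by (meson N.subset subset_trans)
  \<comment> \<open>A sum serves as upper bound in place of a maximum and needs no separate case for
    empty \<open>T\<close>.\<close>
  define D where "D = (\<Sum>t\<in>T. len t)"
  have D: "len t \<le> D" if "t \<in> T" for t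
    unfolding D_def using T(1) that by (intro member_le_sum) auto
  have "D \<ge> 0"
    unfolding D_def by (simp add: sum_nonneg)
  \<comment> \<open>The summand \<open>len z\<close> pays for passing from \<open>u\<close> to
    \<open>u \<otimes> z\<close>; one \<open>D\<close> pays for the step from \<open>u\<close>
    across level \<open>M\<close>, the other for the step of a path into the ball.\<close>
  define R where "R z = len z + 2 * D" for z
  obtain Z where Z: "finite Z" "Z \<subseteq> carrier G"
    and minimum: "\<And>u t. u \<in> carrier G \<Longrightarrow> t \<in> T \<Longrightarrow> len (u \<otimes> t) \<noteq> len u \<Longrightarrow>
       \<exists>z\<in>Z. \<forall>y\<in>carrier G. len y \<le> R z \<longrightarrow> len (u \<otimes> z \<otimes> y) = len (u \<otimes> z) + len y"
    by (rule finite_local_minima_uniform[OF T, of R]) (use \<open>D \<ge> 0\<close> in \<open>auto simp: R_def\<close>)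
  \<comment> \<open>Large enough that \<open>\<one>\<close> lies outside every ball of radius
    \<open>R z\<close> used below.\<close>
  define M where "M = (\<Sum>z\<in>Z. len z + R z) + D"
  have M: "len z + R z + D \<le> M" if "z \<in> Z" for z
    unfolding M_def using Z(1) that \<open>D \<ge> 0\<close>
    by (intro add_right_mono member_le_sum[of z Z "\<lambda>z. len z + R z"]) (auto simp: R_def)
  have "M \<ge> 0"
    unfolding M_def using \<open>D \<ge> 0\<close> by (intro add_nonneg_nonneg sum_nonneg) (auto simp: R_def)
  \<comment> \<open>\<open>K\<close> is the component of \<open>\<one>\<close> in the part of the Cayley graph of length at most \<open>M\<close>.\<close>
  define step where "step = {(u, u \<otimes> t) | u t. t \<in> T \<and> len (u \<otimes> t) \<le> M}"
  define K where "K = step\<^sup>* `` {\<one>}"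
  have K: "u \<in> carrier G \<and> len u \<le> M" if "u \<in> K" for u
  proof -
    have "(\<one>, u) \<in> step\<^sup>*"
      using that by (simp add: K_def)
    then show ?thesis
      by induction (use TG \<open>M \<ge> 0\<close> in \<open>auto simp: step_def\<close>)
  qed
  have K_mult: "u \<otimes> t \<in> K" if u: "u \<in> K" and t: "t \<in> T" for u t
  proof (cases "len (u \<otimes> t) \<le> M")
    case True
    then have "(u, u \<otimes> t) \<in> step"
      using t by (auto simp: step_def)
    then show ?thesis
      using u by (auto simp: K_def)
  next
    case False
    have uG: "u \<in> carrier G" and tG: "t \<in> carrier G"
      using u K t TG by auto
    have u_large: "len u > M - D"
      using False len_mult_le[OF uG tG] D[OF t] by linarith
    obtain z where z: "z \<in> Z" and
      min: "\<And>y. y \<in> carrier G \<Longrightarrow> len y \<le> R z \<Longrightarrow> len (u \<otimes> z \<otimes> y) = len (u \<otimes> z) + len y"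
      using minimum[OF uG t] False K[OF u] by auto
    have zG: "z \<in> carrier G"
      using z Z by blast
    define c where "c = u \<otimes> z"
    have cG: "c \<in> carrier G"
      using uG zG by (simp add: c_def)
    have u_eq: "u = c \<otimes> inv z"
      using uG zG by (simp add: c_def m_assoc)
    have len_c: "len u \<le> len c + len z"
      using len_mult_le[of c "inv z"] cG zG by (simp add: u_eq[symmetric] len_inv)
    \<comment> \<open>\<open>len (inv c \<otimes> w)\<close> is the distance from \<open>c\<close>
      to \<open>w\<close>: no path within level \<open>M\<close> enters the ball about
      \<open>c\<close>.\<close>
    have outside: "len (inv c \<otimes> w) > R z" if "w \<in> K" for w
    proof -
      have "(\<one>, w) \<in> step\<^sup>*"
        using that by (simp add: K_def)
      then have "w \<in> carrier G \<and> len (inv c \<otimes> w) > R z"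
      proof induction
        case base
        then show ?case
          using M[OF z] u_large len_c cG by (simp add: len_inv)
      next
        case (step w w')
        then obtain s where s: "s \<in> T" "w' = w \<otimes> s" "len w' \<le> M" and wG: "w \<in> carrier G"
          by (auto simp: step_def)
        then have sG: "s \<in> carrier G" and w'G: "w' \<in> carrier G"
          using TG by auto
        define y where "y = inv c \<otimes> w'"
        have yG: "y \<in> carrier G" and y: "w' = c \<otimes> y"
          using cG w'G by (simp_all add: y_def m_assoc[symmetric])
        have "inv c \<otimes> w = y \<otimes> inv s"
          using cG wG sG by (simp add: y_def s(2) m_assoc)
        then have y_large: "len y > R z - D"
          using step.IH len_mult_le[of y "inv s"] yG sG D[OF s(1)] by (simp add: len_inv)
        have "len y > R z"
        proof (rule ccontr)
          assume "\<not> len y > R z"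
          then have "len w' = len c + len y"
            using min[OF yG] by (simp add: y c_def)
          then show False
            using y_large len_c u_large s(3) by (simp add: R_def)
        qed
        then show ?case
          using w'G by (simp add: y_def)
      qed
      then show ?thesis by simp
    qed
    \<comment> \<open>Yet \<open>u \<in> K\<close> is at distance \<open>len z \<le> R z\<close>
      from \<open>c\<close>, so this case is contradictory.\<close>
    have "inv c \<otimes> u = inv z"
      using cG zG by (simp add: u_eq m_assoc[symmetric])
    then show ?thesis
      using outside[OF u] zG \<open>D \<ge> 0\<close> by (simp add: len_inv R_def)
  qed
  \<comment> \<open>Quantifying over all \<open>u \<in> K\<close> lets products pass through the
    induction; inverses of generators are covered by \<open>T\<close>.\<close>
  have "\<forall>u\<in>K. u \<otimes> x \<in> K" if "x \<in> generate G S" for x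
    using that
  proof induction
    case one
    then show ?case using K by simp
  next
    case (eng x y)
    have "x \<in> carrier G" "y \<in> carrier G"
      using eng.hyps generate_in_carrier S N.subset by blast+
    then show ?case
      using eng.IH K by (metis m_assoc)
  qed (auto intro!: K_mult simp: T_def)
  moreover have "\<one> \<in> K"
    by (simp add: K_def)
  moreover have "generate G S \<subseteq> carrier G"
    using S N.subset by (intro generate_incl) blast
  ultimately have "generate G S \<subseteq> K"
    by (metis l_one subset_eq)
  also have "K \<subseteq> {u \<in> carrier G. len u \<le> M}"
    using K by blast
  finally show ?thesis
    using finite_ball finite_subset by blast
qed

lemma locally_finite_annihilator:
  "locally_finite_group (G\<lparr>carrier := annihilator G (metric_boundary G d)\<rparr>)"
  unfolding locally_finite_group_def
proof (intro conjI allI impI)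
  let ?N = "annihilator G (metric_boundary G d)"
  show "group (G\<lparr>carrier := ?N\<rparr>)"
    by (rule subgroup_imp_group[OF subgroup_annihilator])
  fix H
  assume H: "subgroup H (G\<lparr>carrier := ?N\<rparr>) \<and>
    finitely_generated_group (G\<lparr>carrier := ?N, carrier := H\<rparr>)"
  then have HN: "H \<subseteq> ?N" and HG: "subgroup H G"
    using subgroup.subset[of H "G\<lparr>carrier := ?N\<rparr>"] incl_subgroup[OF subgroup_annihilator]
    by auto
  obtain S where S: "finite S" "S \<subseteq> H" "generate (G\<lparr>carrier := H\<rparr>) S = H"
    using H by (auto simp: finitely_generated_group_def)
  then show "finite H"
    using finite_generate_annihilator[of S] generate_consistent[OF S(2) HG] HN by auto
qed

end

theorem proposition1p6:
  fixes G :: "('a, 'b) monoid_scheme" and d :: "'a \<Rightarrow> 'a \<Rightarrow> real"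
  assumes "finitely_generated_group G"
    and "Metric_space (carrier G) d"
    and "left_invariant_metric G d"
    and "proper_metric G d"
    and "\<And>x y. x \<in> carrier G \<Longrightarrow> y \<in> carrier G \<Longrightarrow> d x y \<in> \<int>"
  shows "locally_finite_group (G\<lparr>carrier := annihilator G (metric_boundary G d)\<rparr>)"
proof -
  have "proper_integral_metric_group G d"
    using assms
    by (auto simp: proper_integral_metric_group_def proper_integral_metric_group_axioms_def
        finitely_generated_group_def)
  then show ?thesis
    by (rule proper_integral_metric_group.locally_finite_annihilator)
qed

end
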